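(* Let $\{\ell_n\}_{n\in\mathbb{N}}$ be a strictly increasing sequence in $(0,\infty)$ with $\ell_n \to \infty$ and $$\lim_{n\to\infty} \frac{\ell_{n+1}}{\ell_n} = 1,$$ and let $f : (0,\infty) \to \mathbb{R}$ be a continuous function such that the limit $\lim_{n\to\infty} f(\ell_n x)$ exists in $\mathbb{R}$ for all $x \in (0,\infty)$. Then the limit $\lim_{x\to\infty} f(x)$ also exists in $\mathbb{R}$.
   Context: Here $\mathbb{N}=\{1,2,\ldots\}$, and "the limit exists" means that it exists as a finite real number. The limits $\lim_{n\to\infty} f(\ell_n x)$ are not assumed to be equal for different $x$. *)

theory Defs
  imports "HOL-Analysis.Analysis"
begin

end

theory Submission
  imports Defs
begin

text \<open>
  The Baire category theorem turns pointwise convergence into approximate uniform convergence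
  on some interval. Given \<open>\<epsilon> > 0\<close>, the points of \<open>[1,2]\<close> at which all later terms of the
  sequence \<open>f (l n * x)\<close> stay within \<open>\<epsilon>\<close> of the \<open>N\<close>-th one form closed sets whose
  union over \<open>N\<close> is \<open>[1,2]\<close>, so one of them contains an interval
  (\<open>approx_uniform_on_subinterval\<close>). On a shorter interval \<open>[c,d]\<close> the single continuous
  function \<open>f (l N * x)\<close> also oscillates by at most \<open>\<epsilon>\<close>, hence every \<open>f (l n * x)\<close> with
  \<open>n \<ge> N\<close> and \<open>x \<in> [c,d]\<close> is within \<open>2 \<epsilon>\<close> of one fixed number \<open>y\<close>. Since
  \<open>l (n+1) / l n \<longrightarrow> 1\<close>, consecutive intervals \<open>l n * [c,d]\<close> eventually overlap and so cover a
  whole half-line (\<open>dilates_cover_half_line\<close>). Thus \<open>f\<close> has oscillation at most \<open>4 \<epsilon>\<close> near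
  infinity. The limit of \<open>f\<close> is then the limit along the particular sequence \<open>l n\<close>.
\<close>

lemma closed_cover_has_subinterval:
  fixes A :: "nat \<Rightarrow> real set"
  assumes closed: "\<And>N. closed (A N)" and cover: "{a..b} \<subseteq> (\<Union>N. A N)" and "a < b"
  shows "\<exists>N c d. a \<le> c \<and> c < d \<and> d \<le> b \<and> {c..d} \<subseteq> A N"
proof (rule ccontr)
  assume no_interval: "\<not> ?thesis"
  let ?U = "\<lambda>N. {a..b} - A N"
  have "{a..b} \<subseteq> closure (\<Inter> (range ?U))"
  proof (rule Baire)
    fix T assume "T \<in> range ?U"
    then obtain N where T: "T = {a..b} - A N" by auto
    have "openin (top_of_set {a..b}) T"
      unfolding T openin_open by (rule exI[of _ "- A N"]) (use closed in auto)
    moreover have "{a..b} \<subseteq> closure T"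
    proof
      fix x assume x: "x \<in> {a..b}"
      show "x \<in> closure T"
        unfolding closure_approachable
      proof safe
        fix e :: real assume "0 < e"
        define c d where "c = max a (x - e / 2)" and "d = min b (x + e / 2)"
        have cd: "a \<le> c" "c < d" "d \<le> b"
          using x \<open>0 < e\<close> \<open>a < b\<close> by (auto simp: c_def d_def)
        then obtain y where y: "y \<in> {c..d}" "y \<notin> A N"
          using no_interval by blast
        then have "y \<in> T" using cd by (auto simp: T)
        moreover have "dist y x < e"
          using y \<open>0 < e\<close> by (auto simp: c_def d_def dist_real_def)
        ultimately show "\<exists>y\<in>T. dist y x < e" by blast
      qed
    qed
    ultimately show "openin (top_of_set {a..b}) T \<and> {a..b} \<subseteq> closure T" ..
  qed auto
  moreover have "\<Inter> (range ?U) = {}" using cover by blast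
  ultimately have "{a..b} = {}" by (metis closure_empty subset_empty)
  then show False using \<open>a < b\<close> by simp
qed

text \<open>
  The estimate below compares with the \<open>N\<close>-th function at one and the same point \<open>c\<close>, so it
  combines the Baire argument, which controls the dependence on \<open>n\<close>, with continuity of the
  single function \<open>g N\<close>, which controls the dependence on \<open>x\<close>.
\<close>

lemma approx_uniform_on_subinterval:
  fixes g :: "nat \<Rightarrow> real \<Rightarrow> real"
  assumes cont: "\<And>n. continuous_on {a..b} (g n)"
    and conv: "\<And>x. x \<in> {a..b} \<Longrightarrow> convergent (\<lambda>n. g n x)"
    and "a < b" and "0 < \<epsilon>"
  shows "\<exists>N c d. a \<le> c \<and> c < d \<and> d \<le> b \<and>
    (\<forall>n\<ge>N. \<forall>x\<in>{c..d}. \<bar>g n x - g N c\<bar> \<le> 2 * \<epsilon>)"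
proof -
  define A where "A N = {x \<in> {a..b}. \<forall>n\<in>{N..}. \<bar>g n x - g N x\<bar> \<le> \<epsilon>}" for N
  have "closed (A N)" for N
  proof -
    have "A N = {a..b} \<inter> (\<Inter>n\<in>{N..}. {x \<in> {a..b}. \<bar>g n x - g N x\<bar> \<le> \<epsilon>})"
      by (auto simp: A_def)
    also have "closed \<dots>"
      by (intro closed_Int closed_INT ballI continuous_closed_preimage_constant
          continuous_on_closed_Collect_le continuous_intros cont closed_atLeastAtMost)
    finally show ?thesis .
  qed
  moreover have "{a..b} \<subseteq> (\<Union>N. A N)"
  proof
    fix x assume x: "x \<in> {a..b}"
    then have "Cauchy (\<lambda>n. g n x)" using conv by (simp add: convergent_Cauchy)
    then obtain N where "\<And>m n. m \<ge> N \<Longrightarrow> n \<ge> N \<Longrightarrow> dist (g m x) (g n x) < \<epsilon>"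
      using \<open>0 < \<epsilon>\<close> unfolding Cauchy_def by blast
    then have "x \<in> A N" using x by (fastforce simp: A_def dist_real_def)
    then show "x \<in> (\<Union>N. A N)" by blast
  qed
  ultimately obtain N c d where cd: "a \<le> c" "c < d" "d \<le> b" and A: "{c..d} \<subseteq> A N"
    using closed_cover_has_subinterval[of A a b] \<open>a < b\<close> by blast
  have "c \<in> {a..b}" using cd by auto
  then obtain \<delta> where "0 < \<delta>"
    and \<delta>: "\<And>x. x \<in> {a..b} \<Longrightarrow> dist x c < \<delta> \<Longrightarrow> dist (g N x) (g N c) < \<epsilon>"
    using cont[of N] \<open>0 < \<epsilon>\<close> unfolding continuous_on_iff by metis
  define e where "e = min d (c + \<delta> / 2)"
  have e: "c < e" "e \<le> d" using cd \<open>0 < \<delta>\<close> by (auto simp: e_def)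
  have "\<bar>g n x - g N c\<bar> \<le> 2 * \<epsilon>" if "n \<ge> N" "x \<in> {c..e}" for n x
  proof -
    have "\<bar>g n x - g N x\<bar> \<le> \<epsilon>" using subsetD[OF A, of x] that e by (auto simp: A_def)
    moreover have "\<bar>g N x - g N c\<bar> < \<epsilon>"
      using \<delta>[of x] that e cd \<open>0 < \<delta>\<close> by (auto simp: dist_real_def e_def)
    ultimately show ?thesis by linarith
  qed
  then show ?thesis using cd e by (meson order_trans)
qed

text \<open>
  For a large \<open>t\<close>, stop at the last index before \<open>l * c\<close> first exceeds \<open>t\<close>: the next
  ratio is less than \<open>d / c\<close>, so \<open>t\<close> cannot have passed \<open>l * d\<close> yet.
\<close>

lemma dilates_cover_half_line:
  fixes l :: "nat \<Rightarrow> real"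
  assumes pos: "eventually (\<lambda>n. 0 < l n) sequentially"
    and lim: "filterlim l at_top sequentially"
    and ratio: "(\<lambda>n. l (Suc n) / l n) \<longlonglongrightarrow> 1"
    and "0 < c" "c < d"
  shows "eventually (\<lambda>t. \<exists>n\<ge>N. \<exists>x\<in>{c..d}. t = l n * x) at_top"
proof -
  have "eventually (\<lambda>n. l (Suc n) / l n < d / c) sequentially"
    using order_tendstoD(2)[OF ratio, of "d / c"] \<open>0 < c\<close> \<open>c < d\<close> by simp
  from eventually_conj[OF pos this] obtain M0
    where M0: "\<And>n. n \<ge> M0 \<Longrightarrow> 0 < l n \<and> l (Suc n) / l n < d / c"
    unfolding eventually_sequentially by blast
  define M where "M = max N M0"
  have "\<exists>n\<ge>N. \<exists>x\<in>{c..d}. t = l n * x" if t: "t \<ge> l M * c" for t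
  proof -
    let ?P = "\<lambda>k. k \<ge> M \<and> t < l (Suc k) * c"
    have "eventually (\<lambda>n. t / c < l n) sequentially"
      using lim by (simp add: filterlim_at_top_dense)
    then obtain K where K: "\<And>n. n \<ge> K \<Longrightarrow> t / c < l n"
      unfolding eventually_sequentially by blast
    have "?P (max K M)" using K[of "Suc (max K M)"] \<open>0 < c\<close> by (auto simp: field_simps)
    then obtain k where k: "?P k" and least: "\<And>j. j < k \<Longrightarrow> \<not> ?P j"
      using exists_least_iff[of ?P] by blast
    have lower: "l k * c \<le> t"
    proof (cases "k = M")
      case False
      then have "k = Suc (k - 1)" "k - 1 \<ge> M" "k - 1 < k" using k by auto
      then show ?thesis using least[of "k - 1"] by auto
    qed (use t in simp)
    have lk: "0 < l k" "l (Suc k) / l k < d / c" using M0[of k] k by (auto simp: M_def)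
    then have "l (Suc k) * c < l k * d" using \<open>0 < c\<close> by (simp add: field_simps)
    then have "t / l k \<in> {c..d}" using lower k lk by (auto simp: field_simps)
    moreover have "t = l k * (t / l k)" using lk by simp
    moreover have "k \<ge> N" using k by (simp add: M_def)
    ultimately show ?thesis by blast
  qed
  then show ?thesis unfolding eventually_at_top_linorder by blast
qed

theorem mainTheorem7:
  fixes l :: "nat \<Rightarrow> real" and f :: "real \<Rightarrow> real"
  assumes "\<And>n. n \<ge> 1 \<Longrightarrow> 0 < l n"
    and "strict_mono_on {1..} l"
    and "filterlim l at_top sequentially"
    and "(\<lambda>n. l (n + 1) / l n) \<longlonglongrightarrow> 1"
    and "continuous_on {0<..} f"
    and "\<And>x. 0 < x \<Longrightarrow> \<exists>L. (\<lambda>n. f (l n * x)) \<longlonglongrightarrow> L"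
  shows "\<exists>L. (f \<longlongrightarrow> L) at_top"
proof -
  obtain L where L: "(\<lambda>n. f (l n)) \<longlonglongrightarrow> L" using assms(6)[of 1] by auto
  have "eventually (\<lambda>t. dist (f t) L < e) at_top" if "0 < e" for e
  proof -
    \<comment> \<open>\<open>f t\<close> and \<open>L\<close> will both be within \<open>2 * \<epsilon>\<close> of one number, and \<open>4 * \<epsilon> < e\<close>.\<close>
    define \<epsilon> where "\<epsilon> = e / 5"
    have "0 < \<epsilon>" using that by (simp add: \<epsilon>_def)
    \<comment> \<open>The shift by one avoids \<open>l 0\<close>, whose sign is arbitrary.\<close>
    define g where "g n x = f (l (Suc n) * x)" for n x
    have "continuous_on {1..2} (g n)" for n
      unfolding g_def
      by (rule continuous_on_compose2[OF assms(5)])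
        (auto intro!: continuous_intros mult_pos_pos assms(1))
    moreover have "convergent (\<lambda>n. g n x)" if x: "x \<in> {1..2}" for x
    proof -
      obtain K where "(\<lambda>n. f (l n * x)) \<longlonglongrightarrow> K" using assms(6)[of x] x by auto
      then show ?thesis unfolding g_def by (rule convergentI[OF LIMSEQ_Suc])
    qed
    ultimately have "\<exists>N c d. 1 \<le> c \<and> c < d \<and> d \<le> 2 \<and>
        (\<forall>n\<ge>N. \<forall>x\<in>{c..d}. \<bar>g n x - g N c\<bar> \<le> 2 * \<epsilon>)"
      using \<open>0 < \<epsilon>\<close> by (intro approx_uniform_on_subinterval) auto
    then obtain N c d where "1 \<le> c" "c < d"
      and near: "\<And>n x. n \<ge> N \<Longrightarrow> x \<in> {c..d} \<Longrightarrow> \<bar>g n x - g N c\<bar> \<le> 2 * \<epsilon>"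
      by blast
    have "eventually (\<lambda>n. 0 < l n) sequentially"
      using assms(1) unfolding eventually_sequentially by blast
    then have "eventually (\<lambda>t. \<exists>n\<ge>Suc N. \<exists>x\<in>{c..d}. t = l n * x) at_top"
      using dilates_cover_half_line[of l c d] assms(3,4) \<open>1 \<le> c\<close> \<open>c < d\<close> by simp
    then have ev: "eventually (\<lambda>t. \<bar>f t - g N c\<bar> \<le> 2 * \<epsilon>) at_top"
    proof eventually_elim
      case (elim t)
      then obtain n x where "n \<ge> Suc N" "x \<in> {c..d}" "t = l n * x" by blast
      then show ?case using near[of "n - 1" x] by (auto simp: g_def)
    qed
    have "eventually (\<lambda>n. \<bar>f (l n) - g N c\<bar> \<le> 2 * \<epsilon>) sequentially"
      using filterlim_iff[THEN iffD1, OF assms(3)] ev by blast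
    moreover have "(\<lambda>n. \<bar>f (l n) - g N c\<bar>) \<longlonglongrightarrow> \<bar>L - g N c\<bar>"
      by (intro tendsto_rabs tendsto_diff L tendsto_const)
    ultimately have "\<bar>L - g N c\<bar> \<le> 2 * \<epsilon>"
      by (intro tendsto_upperbound[OF _ _ sequentially_bot])
    then have "dist (f t) L < e" if "\<bar>f t - g N c\<bar> \<le> 2 * \<epsilon>" for t
      using that \<open>0 < \<epsilon>\<close> unfolding dist_real_def \<epsilon>_def by linarith
    with ev show ?thesis by (rule eventually_mono)
  qed
  then show ?thesis unfolding tendsto_iff by blast
qed

end
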